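(* The M\"obius ladder graph $K_{5,5}\setminus C_{10}$ (the graph obtained from the complete bipartite graph $K_{5,5}$ by deleting the edges of a Hamiltonian cycle, which has length $10$) is not weakly norming.
   Context: Let $\mathcal{W}$ be the real vector space of symmetric bounded measurable functions $W:[0,1]^2\to\mathbb{R}$. For a graph $H$ and $W\in\mathcal{W}$, the homomorphism density is $t_H(W)=\int_{[0,1]^{V(H)}}\prod_{ij\in E(H)}W(x_i,x_j)\,d\mu^{v(H)}$, where $\mu$ is Lebesgue measure. Set $\|W\|_{r(H)}:=t_H(|W|)^{1/e(H)}$. A graph $H$ is called weakly norming if $\|\cdot\|_{r(H)}$ is a norm on $\mathcal{W}$. *)

theory Defs
  imports "HOL-Analysis.Analysis"
begin

abbreviation unit_square :: "(real \<times> real) set" where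
  "unit_square \<equiv> {0..1} \<times> {0..1}"

text \<open>Values of a kernel outside the unit square are irrelevant.\<close>

definition kernels :: "(real \<times> real \<Rightarrow> real) set" where
  "kernels = {W. W \<in> borel_measurable (lebesgue_on unit_square) \<and>
                 bounded (W ` unit_square) \<and>
                 (\<forall>x\<in>{0..1}. \<forall>y\<in>{0..1}. W (x, y) = W (y, x))}"

text \<open>A graph is given by a vertex set \<open>V\<close> and a set \<open>E\<close> of two-element subsets of \<open>V\<close>.
  The weight of an edge \<open>{i, j}\<close> is \<open>W (x i, x j)\<close>, which does not depend on the order of the
  endpoints if \<open>W\<close> is symmetric; see \<open>edge_weight_eq\<close>.\<close>

definition edge_weight :: "(real \<times> real \<Rightarrow> real) \<Rightarrow> ('v \<Rightarrow> real) \<Rightarrow> 'v set \<Rightarrow> real" where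
  "edge_weight W x e = (THE w. \<exists>i j. e = {i, j} \<and> w = W (x i, x j))"

lemma edge_weight_eq:
  assumes "W (x i, x j) = W (x j, x i)"
  shows "edge_weight W x {i, j} = W (x i, x j)"
  unfolding edge_weight_def using assms by (intro the_equality) (auto simp: doubleton_eq_iff)

text \<open>The completion makes the integrand measurable for every Lebesgue (not only Borel)
  measurable kernel.\<close>

definition cube_measure :: "'v set \<Rightarrow> ('v \<Rightarrow> real) measure" where
  "cube_measure V = completion (PiM V (\<lambda>_. restrict_space lborel {0..1}))"

definition hom_density :: "'v set \<Rightarrow> 'v set set \<Rightarrow> (real \<times> real \<Rightarrow> real) \<Rightarrow> real" where
  "hom_density V E W = (\<integral>x. (\<Prod>e\<in>E. edge_weight W x e) \<partial>cube_measure V)"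

definition r_norm :: "'v set \<Rightarrow> 'v set set \<Rightarrow> (real \<times> real \<Rightarrow> real) \<Rightarrow> real" where
  "r_norm V E W = hom_density V E (\<lambda>p. \<bar>W p\<bar>) powr (1 / real (card E))"

text \<open>As usual for function spaces, kernels that agree almost everywhere are identified.\<close>

definition norm_on_kernels :: "((real \<times> real \<Rightarrow> real) \<Rightarrow> real) \<Rightarrow> bool" where
  "norm_on_kernels N \<longleftrightarrow>
     (\<forall>W\<in>kernels. 0 \<le> N W) \<and>
     (\<forall>W\<in>kernels. N W = 0 \<longleftrightarrow> (AE p in lebesgue_on unit_square. W p = 0)) \<and>
     (\<forall>c. \<forall>W\<in>kernels. N (\<lambda>p. c * W p) = \<bar>c\<bar> * N W) \<and>
     (\<forall>U\<in>kernels. \<forall>W\<in>kernels. N (\<lambda>p. U p + W p) \<le> N U + N W)"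

definition weakly_norming :: "'v set \<Rightarrow> 'v set set \<Rightarrow> bool" where
  "weakly_norming V E \<longleftrightarrow> norm_on_kernels (r_norm V E)"

definition complete_bipartite_edges :: "'v set \<Rightarrow> 'v set \<Rightarrow> 'v set set" where
  "complete_bipartite_edges A B = {{a, b} | a b. a \<in> A \<and> b \<in> B}"

definition cycle_edges :: "'v list \<Rightarrow> 'v set set" where
  "cycle_edges vs = {{vs ! i, vs ! (Suc i mod length vs)} | i. i < length vs}"

text \<open>\<open>C\<close> is the edge set of a Hamiltonian cycle of the graph with vertices \<open>V\<close> and
  edges \<open>E\<close>.\<close>

definition hamiltonian_cycle :: "'v set \<Rightarrow> 'v set set \<Rightarrow> 'v set set \<Rightarrow> bool" where
  "hamiltonian_cycle V E C \<longleftrightarrow>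
     (\<exists>vs. distinct vs \<and> 3 \<le> length vs \<and> set vs = V \<and> C = cycle_edges vs \<and> C \<subseteq> E)"

end

theory Submission
  imports Defs "HOL-Probability.Infinite_Product_Measure"
begin

text \<open>
  If \<open>t\<^sub>H(|W|)\<^bsup>1/15\<^esup>\<close> satisfied the triangle inequality, then the convexity of \<open>x\<^sup>1\<^sup>5\<close> would give
  \<open>t\<^sub>H(U + W) \<le> 2\<^sup>1\<^sup>4 (t\<^sub>H(U) + t\<^sub>H(W))\<close> for nonnegative kernels.  This fails for two explicit
  kernels that are constant on the nine squares of side \<open>1/3\<close>.  They are perturbations of a
  weighted path \<open>2 - 0 - 1\<close> with a loop at \<open>1\<close>, a point at which the Hessian of
  \<open>t\<^sub>H\<close> has a negative eigenvalue; \<open>U\<close> adds a loop at \<open>2\<close> and \<open>W\<close> the edge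
  \<open>{1, 2}\<close>.  The entries were found by a numerical search.  Since \<open>H\<close> is the Moebius ladder,
  weighted homomorphisms into a 3-vertex target are counted by a transfer operator that
  moves from rung to rung.
\<close>

section \<open>Integrals of step functions over the cube\<close>

text \<open>The integrand depends only on the class \<open>g (x v)\<close> of each coordinate, so it
  is a finite combination of indicators of boxes on which all classes are fixed; boxes have product
  measure.\<close>

lemma integral_PiM_finite_range:
  fixes g :: "'a \<Rightarrow> 'b" and \<Phi> :: "('v \<Rightarrow> 'b) \<Rightarrow> real"
  assumes "prob_space M" "finite V" "finite K"
    and g: "g \<in> M \<rightarrow>\<^sub>M count_space K"
  shows "(\<lambda>x. \<Phi> (\<lambda>v\<in>V. g (x v))) \<in> borel_measurable (PiM V (\<lambda>_. M))"
    and "(\<integral>x. \<Phi> (\<lambda>v\<in>V. g (x v)) \<partial>PiM V (\<lambda>_. M)) =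
      (\<Sum>c\<in>PiE V (\<lambda>_. K). \<Phi> c * (\<Prod>v\<in>V. measure M (g -` {c v} \<inter> space M)))"
proof -
  interpret prob_space M by fact
  interpret product_prob_space "\<lambda>_. M" V by unfold_locales
  interpret finite_product_prob_space "\<lambda>_. M" V by unfold_locales fact
  let ?P = "PiM V (\<lambda>_. M)"
  let ?B = "\<lambda>c. PiE V (\<lambda>v. g -` {c v} \<inter> space M)"
  have gK: "g x \<in> K" if "x \<in> space M" for x
    using measurable_space[OF g that] by simp
  have fK: "finite (PiE V (\<lambda>_. K))"
    using assms by (intro finite_PiE)
  have sets1: "g -` {c v} \<inter> space M \<in> sets M" if "c \<in> PiE V (\<lambda>_. K)" "v \<in> V" for c v
    using measurable_sets[OF g, of "{c v}"] that by auto
  have sets: "?B c \<in> sets ?P" if "c \<in> PiE V (\<lambda>_. K)" for c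
    using sets1 that \<open>finite V\<close> by (intro sets_PiM_I_finite)
  have expand: "\<Phi> (\<lambda>v\<in>V. g (x v)) = (\<Sum>c\<in>PiE V (\<lambda>_. K). \<Phi> c * indicator (?B c) x)"
    if x: "x \<in> space ?P" for x
  proof -
    let ?d = "\<lambda>v\<in>V. g (x v)"
    have d: "?d \<in> PiE V (\<lambda>_. K)"
      using x gK by (auto simp: space_PiM PiE_iff)
    have "x \<in> ?B c \<longleftrightarrow> c = ?d" if "c \<in> PiE V (\<lambda>_. K)" for c
      using x that by (auto simp: space_PiM PiE_iff extensional_def fun_eq_iff)
    then have "(\<Sum>c\<in>PiE V (\<lambda>_. K). \<Phi> c * indicator (?B c) x) =
        (\<Sum>c\<in>PiE V (\<lambda>_. K). if c = ?d then \<Phi> c else 0)"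
      by (intro sum.cong) (auto simp: indicator_def)
    also have "\<dots> = \<Phi> ?d"
      using d fK by simp
    finally show ?thesis by simp
  qed
  have meas: "(\<lambda>x. \<Sum>c\<in>PiE V (\<lambda>_. K). \<Phi> c * indicator (?B c) x) \<in> borel_measurable ?P"
    using sets by (intro borel_measurable_sum borel_measurable_times borel_measurable_const borel_measurable_indicator)
  show "(\<lambda>x. \<Phi> (\<lambda>v\<in>V. g (x v))) \<in> borel_measurable ?P"
    using meas by (subst measurable_cong[OF expand])
  have "(\<integral>x. \<Phi> (\<lambda>v\<in>V. g (x v)) \<partial>?P) = (\<integral>x. (\<Sum>c\<in>PiE V (\<lambda>_. K). \<Phi> c * indicator (?B c) x) \<partial>?P)"
    by (intro Bochner_Integration.integral_cong refl expand)
  also have "\<dots> = (\<Sum>c\<in>PiE V (\<lambda>_. K). \<Phi> c * measure ?P (?B c))"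
    using sets by (subst Bochner_Integration.integral_sum)
      (auto simp: emeasure_eq_measure intro!: integrable_mult_right integrable_real_indicator sum.cong)
  also have "\<dots> = (\<Sum>c\<in>PiE V (\<lambda>_. K). \<Phi> c * (\<Prod>v\<in>V. measure M (g -` {c v} \<inter> space M)))"
    using sets1 by (intro sum.cong refl arg_cong2[where f="(*)"] finite_measure_PiM_emb) auto
  finally show "(\<integral>x. \<Phi> (\<lambda>v\<in>V. g (x v)) \<partial>?P) =
      (\<Sum>c\<in>PiE V (\<lambda>_. K). \<Phi> c * (\<Prod>v\<in>V. measure M (g -` {c v} \<inter> space M)))" .
qed

definition third :: "real \<Rightarrow> nat" where
  "third x = (if x < 1/3 then 0 else if x < 2/3 then 1 else 2)"

lemma third_less: "third x < 3"
  by (simp add: third_def)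

text \<open>The three cells of \<open>third\<close> have length 1/3 each, so every box weighs
  \<open>1 / 3 ^ card V\<close>. Completing the measure does not change the integral, as the
  integrand is already measurable for the product.\<close>

lemma integral_cube_measure_third:
  fixes \<Phi> :: "('v \<Rightarrow> nat) \<Rightarrow> real"
  assumes "finite V"
  shows "(\<integral>x. \<Phi> (\<lambda>v\<in>V. third (x v)) \<partial>cube_measure V) =
    (\<Sum>c\<in>PiE V (\<lambda>_. {..<3}). \<Phi> c) / 3 ^ card V"
proof -
  let ?M = "restrict_space lborel {0..1::real}"
  have P: "prob_space ?M"
    by (rule prob_spaceI) (simp add: emeasure_restrict_space space_restrict_space)
  have preimage: "third -` {0} \<inter> {0..1} = {0..<1/3}" "third -` {1} \<inter> {0..1} = {1/3..<2/3}"
    "third -` {2} \<inter> {0..1} = {2/3..1}"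
    by (auto simp: third_def split: if_split_asm)
  have interval: "\<exists>J. third -` {k} \<inter> {0..1} = J \<and> J \<in> sets borel \<and> measure lborel J = 1 / 3" if "k < 3" for k
  proof -
    have "k = 0 \<or> k = 1 \<or> k = 2" using that by auto
    then show ?thesis using preimage by (elim disjE) simp_all
  qed
  have m: "measure ?M (third -` {k} \<inter> space ?M) = 1 / 3" if "k < 3" for k
    using interval[OF that] by (auto simp: space_restrict_space measure_restrict_space)
  have g: "third \<in> ?M \<rightarrow>\<^sub>M count_space {..<3}"
    unfolding measurable_count_space_eq2[OF finite_lessThan]
  proof (intro conjI ballI)
    show "third \<in> space ?M \<rightarrow> {..<3}" by (simp add: third_less)
    fix k :: nat assume "k \<in> {..<3}"
    then show "third -` {k} \<inter> space ?M \<in> sets ?M"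
      using interval[of k] by (auto simp: space_restrict_space sets_restrict_space_iff)
  qed
  note I = integral_PiM_finite_range[OF P \<open>finite V\<close> finite_lessThan g]
  have "(\<integral>x. \<Phi> (\<lambda>v\<in>V. third (x v)) \<partial>cube_measure V) =
      (\<integral>x. \<Phi> (\<lambda>v\<in>V. third (x v)) \<partial>PiM V (\<lambda>_. ?M))"
    unfolding cube_measure_def by (rule integral_completion[OF I(1)])
  also have "\<dots> = (\<Sum>c\<in>PiE V (\<lambda>_. {..<3}). \<Phi> c * (\<Prod>v\<in>V. 1 / 3))"
    unfolding I(2) by (intro sum.cong prod.cong refl arg_cong2[where f="(*)"] m) auto
  also have "\<dots> = (\<Sum>c\<in>PiE V (\<lambda>_. {..<3}). \<Phi> c) / 3 ^ card V"
    by (simp add: sum_divide_distrib power_divide)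
  finally show ?thesis .
qed

section \<open>The Moebius ladder\<close>

lemma complete_bipartite_edges_image:
  "complete_bipartite_edges (f ` A) (f ` B) = (`) f ` complete_bipartite_edges A B"
  unfolding complete_bipartite_edges_def by (auto simp: image_iff) blast+

lemma complete_bipartite_edges_commute:
  "complete_bipartite_edges A B = complete_bipartite_edges B A"
  unfolding complete_bipartite_edges_def by (auto simp: insert_commute)

lemma cycle_edges_map: "cycle_edges (map f vs) = (`) f ` cycle_edges vs"
proof -
  have "{map f vs ! i, map f vs ! (Suc i mod length (map f vs))} =
      f ` {vs ! i, vs ! (Suc i mod length vs)}" if "i < length vs" for i
  proof -
    have "Suc i mod length vs < length vs" using that by (intro mod_less_divisor) auto
    then show ?thesis using that by simp
  qed
  then show ?thesis
    unfolding cycle_edges_def setcompr_eq_image image_image by (intro image_cong) auto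
qed

text \<open>The rungs are \<open>{2k, 2k + 1}\<close>, and the two rails \<open>0, 2, 4, 6, 8\<close> and \<open>1, 3, 5, 7, 9\<close>
  are joined crosswise by \<open>{8, 1}\<close> and \<open>{9, 0}\<close>.\<close>

definition ladder :: "nat set set" where
  "ladder = {{0,1}, {2,3}, {4,5}, {6,7}, {8,9},
             {0,2}, {1,3}, {2,4}, {3,5}, {4,6}, {5,7}, {6,8}, {7,9}, {8,1}, {9,0}}"

lemma cycle_edges_eq_set:
  "cycle_edges vs = set (map (\<lambda>i. {vs ! i, vs ! (Suc i mod length vs)}) [0..<length vs])"
  unfolding cycle_edges_def by auto

text \<open>The model case: five is odd, so the crossed ladder is bipartite, and the edges between
  its two sides that it lacks form a single 10-cycle.\<close>

lemma complete_bipartite_minus_cycle: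
  "complete_bipartite_edges {0,3,4,7,8} {1,2,5,6,9} - cycle_edges [0,5,8,2,7,1,4,9,3,6] = ladder"
proof -
  have K: "complete_bipartite_edges (A :: nat set) B = (\<Union>a\<in>A. \<Union>b\<in>B. {{a, b}})" for A B
    unfolding complete_bipartite_edges_def by auto
  show ?thesis
    unfolding K cycle_edges_eq_set ladder_def
    by (simp add: upt_rec numeral_2_eq_2[symmetric] insert_Diff_if doubleton_eq_iff)
      (auto simp: insert_commute)
qed

text \<open>A Hamiltonian cycle alternates between the sides, so positions on it determine both the
  sides and the cycle. Relabelling by position reduces every such cycle to the model one;
  \<open>vs ! 0 \<in> A\<close> puts \<open>A\<close> at the even positions.\<close>

lemma complete_bipartite_minus_hamiltonian_cycle_aux:
  fixes A B :: "'v set"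
  assumes "card A = 5" "card B = 5" "A \<inter> B = {}"
    and vs: "distinct vs" "set vs = A \<union> B" "cycle_edges vs \<subseteq> complete_bipartite_edges A B"
    and "vs ! 0 \<in> A"
  shows "\<exists>f. inj_on f {..<10} \<and> A \<union> B = f ` {..<10} \<and>
    complete_bipartite_edges A B - cycle_edges vs = (`) f ` ladder"
proof -
  have fin: "finite A" "finite B" using assms by (auto intro: card_ge_0_finite)
  have len: "length vs = 10"
    using distinct_card[OF vs(1)] assms fin by (simp add: card_Un_disjoint)
  have edge: "vs ! Suc i \<in> (if vs ! i \<in> A then B else A)" if "Suc i < 10" for i
  proof -
    have "{vs ! i, vs ! Suc i} \<in> cycle_edges vs"
      unfolding cycle_edges_def using that len by (auto intro!: exI[of _ i])
    then have "{vs ! i, vs ! Suc i} \<in> complete_bipartite_edges A B" using vs(3) by blast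
    then show ?thesis
      using \<open>A \<inter> B = {}\<close> by (auto simp: complete_bipartite_edges_def doubleton_eq_iff)
  qed
  have parity: "vs ! i \<in> (if even i then A else B)" if "i < 10" for i
    using that
  proof (induction i)
    case (Suc i)
    then show ?case using edge[of i] \<open>A \<inter> B = {}\<close> by (auto split: if_splits)
  qed (use assms in simp)
  \<comment> \<open>Steps of length 3 along the deleted cycle run through the rails; antipodal vertices
    \<open>i, i + 5\<close> form the rungs.\<close>
  define \<sigma> :: "nat list" where "\<sigma> = [0,5,3,8,6,1,9,4,2,7]"
  define f where "f = (\<lambda>i. vs ! (\<sigma> ! i))"
  have ten: "{..<10} = {0,1,2,3,4,5,6,7,8,9::nat}" by auto
  have inj: "inj_on f {..<10}"
  proof (rule inj_onI)
    fix i j :: nat assume ij: "i \<in> {..<10}" "j \<in> {..<10}" "f i = f j"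
    have s: "\<sigma> ! i < 10" if "i < 10" for i
      using that nth_mem[of i \<sigma>] by (auto simp: \<sigma>_def)
    have "\<sigma> ! i = \<sigma> ! j"
      using ij s nth_eq_iff_index_eq[OF vs(1)] by (simp add: f_def len)
    moreover have "distinct \<sigma>" "length \<sigma> = 10" by (simp_all add: \<sigma>_def)
    ultimately show "i = j" using ij by (simp add: nth_eq_iff_index_eq)
  qed
  \<comment> \<open>The list is the inverse permutation of \<open>\<sigma>\<close>.\<close>
  have vs_f: "vs = map f [0,5,8,2,7,1,4,9,3,6]"
  proof (rule nth_equalityI)
    fix i assume "i < length vs"
    then have "i \<in> {..<10}" using len by simp
    then show "vs ! i = map f [0,5,8,2,7,1,4,9,3,6] ! i"
      unfolding ten by (elim insertE emptyE) (simp_all add: f_def \<sigma>_def)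
  qed (simp add: len)
  \<comment> \<open>\<open>\<sigma>\<close> is even exactly at 0, 3, 4, 7, 8. Counting then turns
    both inclusions into equalities.\<close>
  have fA: "f ` {0,3,4,7,8} \<subseteq> A" and fB: "f ` {1,2,5,6,9} \<subseteq> B"
    using parity[of 0] parity[of 1] parity[of 2] parity[of 3] parity[of 4] parity[of 5]
      parity[of 6] parity[of 7] parity[of 8] parity[of 9]
    by (simp_all add: f_def \<sigma>_def)
  have "inj_on f {0,3,4,7,8}" "inj_on f {1,2,5,6,9}"
    by (rule inj_on_subset[OF inj]; simp)+
  then have "card (f ` {0,3,4,7,8}) = 5" "card (f ` {1,2,5,6,9}) = 5"
    by (simp_all only: card_image) simp_all
  then have A: "A = f ` {0,3,4,7,8}" and B: "B = f ` {1,2,5,6,9}"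
    using card_subset_eq[OF fin(1) fA] card_subset_eq[OF fin(2) fB] assms(1,2) by simp_all
  have AB: "A \<union> B = f ` {..<10}"
    unfolding A B image_Un[symmetric] ten by (rule arg_cong[where f="(`) f"]) auto
  let ?K = "complete_bipartite_edges {0,3,4,7,8} {1,2,5,6,9::nat}"
  let ?C = "cycle_edges [0,5,8,2,7,1,4,9,3,6::nat]"
  \<comment> \<open>Images commute with set difference under injectivity, which is available for
    subsets of \<open>{..<10}\<close>.\<close>
  have "?K \<subseteq> Pow {..<10}" "?C \<subseteq> Pow {..<10}"
    unfolding complete_bipartite_edges_def cycle_edges_eq_set by (auto simp: upt_rec)
  then have "(`) f ` (?K - ?C) = (`) f ` ?K - (`) f ` ?C"
    by (intro inj_on_image_set_diff[OF inj_on_image_Pow[OF inj]]) auto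
  moreover have "complete_bipartite_edges A B = (`) f ` ?K"
    unfolding A B by (rule complete_bipartite_edges_image)
  moreover have "cycle_edges vs = (`) f ` ?C"
    by (subst vs_f) (rule cycle_edges_map)
  ultimately have "complete_bipartite_edges A B - cycle_edges vs = (`) f ` ladder"
    by (simp only: complete_bipartite_minus_cycle)
  then show ?thesis using inj AB by blast
qed

lemma complete_bipartite_minus_hamiltonian_cycle:
  fixes A B :: "'v set"
  assumes "card A = 5" "card B = 5" "A \<inter> B = {}"
    and "hamiltonian_cycle (A \<union> B) (complete_bipartite_edges A B) C"
  obtains f where "inj_on f {..<10}" "A \<union> B = f ` {..<10}"
    "complete_bipartite_edges A B - C = (`) f ` ladder"
proof -
  obtain vs where vs: "distinct vs" "3 \<le> length vs" "set vs = A \<union> B" "C = cycle_edges vs"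
      "C \<subseteq> complete_bipartite_edges A B"
    using assms(4) unfolding hamiltonian_cycle_def by blast
  have "vs ! 0 \<in> set vs" using vs(2) by (intro nth_mem) auto
  then consider "vs ! 0 \<in> A" | "vs ! 0 \<in> B" using vs(3) by blast
  then show thesis
  proof cases
    case 1
    then show ?thesis
      using complete_bipartite_minus_hamiltonian_cycle_aux[of A B vs] assms vs that by blast
  next
    case 2
    \<comment> \<open>The roles of the sides are exchanged; vertices and edges are symmetric in
      them.\<close>
    have "\<exists>f. inj_on f {..<10} \<and> B \<union> A = f ` {..<10} \<and>
        complete_bipartite_edges B A - cycle_edges vs = (`) f ` ladder"
      using 2 assms vs
      by (intro complete_bipartite_minus_hamiltonian_cycle_aux)
        (auto simp: complete_bipartite_edges_commute[of B A])
    then show ?thesis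
      using that vs(4) by (auto simp: complete_bipartite_edges_commute[of B A] Un_commute[of B A])
  qed
qed

lemma prod_ladder:
  fixes w :: "nat set \<Rightarrow> real"
  shows "(\<Prod>e\<in>ladder. w e) = w {0,1} * w {2,3} * w {4,5} * w {6,7} * w {8,9} *
    w {0,2} * w {1,3} * w {2,4} * w {3,5} * w {4,6} * w {5,7} * w {6,8} * w {7,9} * w {8,1} * w {9,0}"
  unfolding ladder_def by (simp add: doubleton_eq_iff mult.assoc)

lemma card_ladder: "card ladder = 15"
  unfolding ladder_def by (simp add: doubleton_eq_iff)

lemma inj_on_image_ladder:
  assumes "inj_on f {..<10}"
  shows "inj_on ((`) f) ladder"
  by (rule inj_on_subset[OF inj_on_image_Pow[OF assms]]) (auto simp: ladder_def)

text \<open>Iterating this turns a sum over all colourings into nested sums, which can then be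
  factored.\<close>

lemma sum_PiE_lessThan_Suc:
  fixes G :: "(nat \<Rightarrow> 'a) \<Rightarrow> real"
  assumes "finite K"
  shows "(\<Sum>c\<in>PiE {..<Suc n} (\<lambda>_. K). G c) = (\<Sum>c\<in>PiE {..<n} (\<lambda>_. K). \<Sum>k\<in>K. G (c(n := k)))"
proof -
  have "(\<Sum>c\<in>PiE {..<Suc n} (\<lambda>_. K). G c) =
      (\<Sum>(k, c)\<in>K \<times> PiE {..<n} (\<lambda>_. K). G (c(n := k)))"
    unfolding lessThan_Suc PiE_insert_eq
    by (subst sum.reindex[OF inj_combinator]) (auto simp: case_prod_unfold)
  also have "\<dots> = (\<Sum>k\<in>K. \<Sum>c\<in>PiE {..<n} (\<lambda>_. K). G (c(n := k)))"
    by (simp add: sum.cartesian_product)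
  finally show ?thesis by (subst sum.swap)
qed

lemma sum_PiE_image:
  fixes G :: "('i \<Rightarrow> 'a) \<Rightarrow> real"
  assumes "inj_on f I"
  shows "(\<Sum>c\<in>PiE (f ` I) (\<lambda>_. K). G (\<lambda>i\<in>I. c (f i))) = (\<Sum>c\<in>PiE I (\<lambda>_. K). G c)"
proof (rule sum.reindex_bij_witness[where i = "\<lambda>c. \<lambda>v\<in>f ` I. c (the_inv_into I f v)"
      and j = "\<lambda>c. \<lambda>i\<in>I. c (f i)"])
  note simps = the_inv_into_f_f[OF assms] f_the_inv_into_f[OF assms]
  show "(\<lambda>v\<in>f ` I. (\<lambda>i\<in>I. c (f i)) (the_inv_into I f v)) = c" if "c \<in> PiE (f ` I) (\<lambda>_. K)" for c
    using that by (fastforce simp: fun_eq_iff simps PiE_iff extensional_def)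
  show "(\<lambda>i\<in>I. (\<lambda>v\<in>f ` I. c (the_inv_into I f v)) (f i)) = c" if "c \<in> PiE I (\<lambda>_. K)" for c
    using that by (fastforce simp: fun_eq_iff simps PiE_iff extensional_def)
qed (auto simp: the_inv_into_f_f[OF assms])

section \<open>Counting homomorphisms of the ladder\<close>

text \<open>\<open>x\<close>, \<open>y\<close> colour the ends of a rung and \<open>u\<close>,
  \<open>v\<close> those of the next one; \<open>g u v\<close> is the total weight of the part from
  that next rung on.\<close>

definition rung_transfer :: "(nat \<Rightarrow> nat \<Rightarrow> real) \<Rightarrow> (nat \<Rightarrow> nat \<Rightarrow> real) \<Rightarrow> nat \<Rightarrow> nat \<Rightarrow> real" where
  "rung_transfer M g x y = M x y * (\<Sum>u<3. M x u * (\<Sum>v<3. M y v * g u v))"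

definition ladder_weight :: "(nat \<Rightarrow> nat \<Rightarrow> real) \<Rightarrow> (nat \<Rightarrow> nat) \<Rightarrow> real" where
  "ladder_weight M c =
     M (c 0) (c 1) * M (c 2) (c 3) * M (c 4) (c 5) * M (c 6) (c 7) * M (c 8) (c 9) *
     M (c 0) (c 2) * M (c 1) (c 3) * M (c 2) (c 4) * M (c 3) (c 5) * M (c 4) (c 6) * M (c 5) (c 7) *
     M (c 6) (c 8) * M (c 7) (c 9) * M (c 8) (c 1) * M (c 9) (c 0)"

definition ladder_homs :: "(nat \<Rightarrow> nat \<Rightarrow> real) \<Rightarrow> real" where
  "ladder_homs M = (\<Sum>c\<in>PiE {..<10} (\<lambda>_. {..<3}). ladder_weight M c)"

text \<open>The colours \<open>x\<close>, \<open>y\<close> of vertices 0 and 1 stay fixed through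
  all four transfers, because the crossing edges lead back to them: on the last rung
  \<open>u\<close> meets \<open>y\<close> and \<open>v\<close> meets \<open>x\<close>.\<close>

lemma ladder_homs_eq_rung_transfer:
  "ladder_homs M = (\<Sum>x<3. \<Sum>y<3.
     rung_transfer M (rung_transfer M (rung_transfer M (rung_transfer M (\<lambda>u v. M u v * M u y * M v x)))) x y)"
proof -
  \<comment> \<open>In successor form, \<open>sum_PiE_lessThan_Suc\<close> peels off all ten
    vertices.\<close>
  have "(10::nat) = Suc (Suc (Suc (Suc (Suc (Suc (Suc (Suc (Suc (Suc 0)))))))))" by simp
  then show ?thesis
    unfolding ladder_homs_def ladder_weight_def rung_transfer_def
    by (simp only: sum_PiE_lessThan_Suc finite_lessThan)
      (simp del: sum.lessThan_Suc add: sum_distrib_left sum_distrib_right mult_ac)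
qed

text \<open>The count is evaluated on explicit lists of length 9, so that the simplifier computes every
  intermediate value only once.\<close>

definition grid :: "real list \<Rightarrow> nat \<Rightarrow> nat \<Rightarrow> real" where
  "grid L x y = L ! (3 * x + y)"

text \<open>On row-major 3 by 3 matrices, entry (u, y) of the result is the inner sum over
  \<open>v\<close> in \<open>rung_transfer\<close>.\<close>

fun contract_snd :: "real list \<Rightarrow> real list \<Rightarrow> real list" where
  "contract_snd [a, b, c, d, e, f, g, h, i] [p, q, r, s, t, u, v, w, x] =
    [a * p + b * q + c * r, d * p + e * q + f * r, g * p + h * q + i * r,
     a * s + b * t + c * u, d * s + e * t + f * u, g * s + h * t + i * u,
     a * v + b * w + c * x, d * v + e * w + f * x, g * v + h * w + i * x]"
| "contract_snd _ _ = []"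

text \<open>Entry (x, y) is the outer sum over \<open>u\<close>, multiplied by the weight of the
  rung.\<close>

fun contract_fst :: "real list \<Rightarrow> real list \<Rightarrow> real list" where
  "contract_fst [a, b, c, d, e, f, g, h, i] [p, q, r, s, t, u, v, w, x] =
    [a * (a * p + b * s + c * v), b * (a * q + b * t + c * w), c * (a * r + b * u + c * x),
     d * (d * p + e * s + f * v), e * (d * q + e * t + f * w), f * (d * r + e * u + f * x),
     g * (g * p + h * s + i * v), h * (g * q + h * t + i * w), i * (g * r + h * u + i * x)]"
| "contract_fst _ _ = []"

definition transfer_list :: "real list \<Rightarrow> real list \<Rightarrow> real list" where
  "transfer_list M g = contract_fst M (contract_snd M g)"

definition start_list :: "real list \<Rightarrow> nat \<Rightarrow> nat \<Rightarrow> real list" where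
  "start_list M x y = map (\<lambda>(u, v). grid M u v * grid M u y * grid M v x)
     [(0,0), (0,1), (0,2), (1,0), (1,1), (1,2), (2,0), (2,1), (2,2)]"

lemma less_3_cases:
  assumes "(x::nat) < 3"
  obtains "x = 0" | "x = 1" | "x = 2"
  using assms by linarith

lemma length_9E:
  assumes "length xs = 9"
  obtains a b c d e f g h i where "xs = [a, b, c, d, e, f, g, h, i]"
  using assms by (auto simp: numeral_eq_Suc length_Suc_conv)

lemma length_transfer_list:
  assumes "length M = 9" "length g = 9"
  shows "length (transfer_list M g) = 9"
  by (rule length_9E[OF assms(1)], rule length_9E[OF assms(2)]) (simp add: transfer_list_def)

lemma lessThan_3: "{..<3} = {0, 1, 2::nat}"
  by auto

lemma grid_transfer_list:
  assumes "length M = 9" "length g = 9" "x < 3" "y < 3"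
  shows "grid (transfer_list M g) x y = rung_transfer (grid M) (grid g) x y"
  by (rule length_9E[OF assms(1)], rule length_9E[OF assms(2)],
      rule less_3_cases[OF assms(3)]; rule less_3_cases[OF assms(4)])
    (simp_all add: transfer_list_def rung_transfer_def grid_def lessThan_3 algebra_simps)

lemma grid_start_list:
  assumes "u < 3" "v < 3"
  shows "grid (start_list M x y) u v = grid M u v * grid M u y * grid M v x"
  by (rule less_3_cases[OF assms(1)]; rule less_3_cases[OF assms(2)])
    (simp_all add: start_list_def grid_def numeral_2_eq_2)

lemma rung_transfer_cong:
  assumes "\<And>u v. u < 3 \<Longrightarrow> v < 3 \<Longrightarrow> g u v = h u v"
  shows "rung_transfer M g x y = rung_transfer M h x y"
  unfolding rung_transfer_def using assms by (auto intro!: sum.cong)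

lemma ladder_homs_grid:
  assumes M: "length M = 9"
  shows "ladder_homs (grid M) = (\<Sum>x<3. \<Sum>y<3. grid (transfer_list M (transfer_list M
    (transfer_list M (transfer_list M (start_list M x y))))) x y)"
  unfolding ladder_homs_eq_rung_transfer
proof (intro sum.cong refl)
  fix x y :: nat assume "x \<in> {..<3}" "y \<in> {..<3}"
  moreover have "length (start_list M x y) = 9" by (simp add: start_list_def)
  ultimately show "rung_transfer (grid M) (rung_transfer (grid M) (rung_transfer (grid M)
      (rung_transfer (grid M) (\<lambda>u v. grid M u v * grid M u y * grid M v x)))) x y =
    grid (transfer_list M (transfer_list M (transfer_list M (transfer_list M (start_list M x y))))) x y"
    \<comment> \<open>The list identities hold for indices below 3; the congruence rule supplies
      these bounds inside the nested transfers.\<close>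
    using M by (simp add: grid_transfer_list length_transfer_list grid_start_list cong: rung_transfer_cong)
qed

lemmas ladder_homs_eval = ladder_homs_grid start_list_def transfer_list_def grid_def
  lessThan_nat_numeral numeral_2_eq_2[symmetric]

text \<open>Exact integers matter: \<open>2 ^ 14\<close> times the sum of the values for
  \<open>U\<close> and \<open>W\<close> falls short of the value for their sum by a relative margin
  of only about 2e-8.\<close>

lemma ladder_homs_U: "ladder_homs (grid [0,98,40,98,135,0,40,0,44]) =
    1009777762945695534094508354448263"
  by (simp add: ladder_homs_eval)

lemma ladder_homs_W: "ladder_homs (grid [0,98,38,98,135,1,38,1,0]) =
    1009830956979098495329525462040825"
  by (simp add: ladder_homs_eval)

lemma ladder_homs_U_plus_W: "ladder_homs (grid [0,196,78,196,270,1,78,1,44]) =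
    33089269964614064246796394797690662242"
  by (simp add: ladder_homs_eval)

section \<open>Step kernels\<close>

definition step_kernel :: "(nat \<Rightarrow> nat \<Rightarrow> real) \<Rightarrow> real \<times> real \<Rightarrow> real" where
  "step_kernel M p = M (third (fst p)) (third (snd p))"

lemma step_kernel_in_kernels:
  assumes sym: "\<And>i j. i < 3 \<Longrightarrow> j < 3 \<Longrightarrow> M i j = M j i"
  shows "step_kernel M \<in> kernels"
proof -
  \<comment> \<open>Spelling out the nine cells leaves only comparisons and constants, which
    \<open>measurable\<close> can handle.\<close>
  have "step_kernel M = (\<lambda>p.
      if fst p < 1/3 then (if snd p < 1/3 then M 0 0 else if snd p < 2/3 then M 0 1 else M 0 2)
      else if fst p < 2/3 then (if snd p < 1/3 then M 1 0 else if snd p < 2/3 then M 1 1 else M 1 2)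
      else (if snd p < 1/3 then M 2 0 else if snd p < 2/3 then M 2 1 else M 2 2))"
    by (auto simp: step_kernel_def third_def fun_eq_iff)
  also have "\<dots> \<in> borel_measurable (borel \<Otimes>\<^sub>M borel)" by measurable
  finally have "step_kernel M \<in> borel_measurable lborel" by (simp add: borel_prod)
  then have "step_kernel M \<in> borel_measurable (lebesgue_on unit_square)"
    by (intro measurable_restrict_space1 measurable_completion)
  moreover have "step_kernel M ` unit_square \<subseteq> (\<lambda>(i, j). M i j) ` ({..<3} \<times> {..<3})"
    by (auto simp: step_kernel_def third_less)
  then have "bounded (step_kernel M ` unit_square)"
    by (intro finite_imp_bounded) (rule finite_subset, auto)
  ultimately show ?thesis
    by (simp add: kernels_def) (simp add: step_kernel_def sym third_less)
qed

text \<open>The integrand sees only the cells of the coordinates, so the density is the average of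
  \<open>ladder_weight\<close> over the \<open>3 ^ 10\<close> colourings.\<close>

lemma hom_density_step_kernel:
  fixes f :: "nat \<Rightarrow> 'v"
  assumes f: "inj_on f {..<10}"
    and sym: "\<And>i j. i < 3 \<Longrightarrow> j < 3 \<Longrightarrow> M i j = M j i"
  shows "hom_density (f ` {..<10}) ((`) f ` ladder) (step_kernel M) = ladder_homs M / 3 ^ 10"
proof -
  let ?V = "f ` {..<10}"
  let ?\<Phi> = "\<lambda>c. ladder_weight M (\<lambda>i\<in>{..<10}. c (f i))"
  have prod: "(\<Prod>e\<in>(`) f ` ladder. w e) = (\<Prod>e\<in>ladder. w (f ` e))" for w :: "'v set \<Rightarrow> real"
    by (simp add: prod.reindex inj_on_image_ladder[OF f])
  have "edge_weight (step_kernel M) x {v, w} = M (third (x v)) (third (x w))" for x and v w :: 'v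
    by (subst edge_weight_eq) (simp_all add: step_kernel_def sym third_less)
  \<comment> \<open>Restricting colourings to \<open>{..<10}\<close> is harmless:
    \<open>ladder_weight\<close> reads only the colours of 0 to 9.\<close>
  then have "(\<Prod>e\<in>(`) f ` ladder. edge_weight (step_kernel M) x e) = ?\<Phi> (\<lambda>v\<in>?V. third (x v))" for x
    by (simp add: prod prod_ladder ladder_weight_def)
  then have "hom_density ?V ((`) f ` ladder) (step_kernel M) =
      (\<Sum>c\<in>PiE ?V (\<lambda>_. {..<3}). ?\<Phi> c) / 3 ^ card ?V"
    unfolding hom_density_def
    by (simp only: integral_cube_measure_third[of ?V ?\<Phi>, OF finite_imageI[OF finite_lessThan]])
  also have "\<dots> = ladder_homs M / 3 ^ 10"
    by (simp only: sum_PiE_image[OF f] card_image[OF f] ladder_homs_def card_lessThan)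
  finally show ?thesis .
qed

text \<open>Nonnegative entries remove the absolute value, and the 15 edges give the exponent 1/15,
  a genuine root of a nonnegative number.\<close>

lemma r_norm_step_kernel:
  fixes f :: "nat \<Rightarrow> 'v"
  assumes f: "inj_on f {..<10}"
    and sym: "\<And>i j. i < 3 \<Longrightarrow> j < 3 \<Longrightarrow> M i j = M j i"
    and nonneg: "\<And>i j. i < 3 \<Longrightarrow> j < 3 \<Longrightarrow> 0 \<le> M i j"
    and "0 \<le> ladder_homs M"
  shows "r_norm (f ` {..<10}) ((`) f ` ladder) (step_kernel M) = root 15 (ladder_homs M / 3 ^ 10)"
proof -
  have "(\<lambda>p. \<bar>step_kernel M p\<bar>) = step_kernel M"
    by (auto simp: step_kernel_def nonneg third_less)
  moreover have "card ((`) f ` ladder) = 15"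
    by (simp add: card_image inj_on_image_ladder[OF f] card_ladder)
  ultimately show ?thesis
    using assms(4) by (simp add: r_norm_def hom_density_step_kernel[OF f sym] root_powr_inverse)
qed

section \<open>Failure of the triangle inequality\<close>

lemma power_15_mean:
  fixes a b :: real
  assumes "0 \<le> a" "0 \<le> b"
  shows "(a + b) ^ 15 \<le> 2 ^ 14 * (a ^ 15 + b ^ 15)"
proof -
  have "convex_on {0..} (\<lambda>x::real. x ^ 15)" by (rule convex_power_odd) simp
  from convex_onD[OF this, of "1/2" a b] assms
  have "((a + b) / 2) ^ 15 \<le> (a ^ 15 + b ^ 15) / 2" by (simp add: field_simps)
  then show ?thesis by (simp add: power_divide field_simps)
qed

theorem theorem1p3:
  fixes A B :: "'v set" and C :: "'v set set"
  assumes "card A = 5" and "card B = 5" and "A \<inter> B = {}"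
    and "hamiltonian_cycle (A \<union> B) (complete_bipartite_edges A B) C"
  shows "\<not> weakly_norming (A \<union> B) (complete_bipartite_edges A B - C)"
proof
  obtain f where f: "inj_on f {..<10}" "A \<union> B = f ` {..<10}"
      "complete_bipartite_edges A B - C = (`) f ` ladder"
    using complete_bipartite_minus_hamiltonian_cycle[OF assms] .
  let ?N = "r_norm (f ` {..<10}) ((`) f ` ladder)"
  define U where "U = grid [0,98,40,98,135,0,40,0,44]"
  define W where "W = grid [0,98,38,98,135,1,38,1,0]"
  define S where "S = grid [0,196,78,196,270,1,78,1,44]"
  assume "weakly_norming (A \<union> B) (complete_bipartite_edges A B - C)"
  then have triangle: "?N (\<lambda>p. u p + w p) \<le> ?N u + ?N w" if "u \<in> kernels" "w \<in> kernels" for u w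
    using that unfolding weakly_norming_def norm_on_kernels_def f(2,3) by blast
  have sym: "X i j = X j i" if "X \<in> {U, W, S}" "i < 3" "j < 3" for X i j
    by (rule less_3_cases[OF that(2)]; rule less_3_cases[OF that(3)]; insert that(1))
      (auto simp: U_def W_def S_def grid_def)
  have nonneg: "0 \<le> X i j" if "X \<in> {U, W, S}" "i < 3" "j < 3" for X i j
    by (rule less_3_cases[OF that(2)]; rule less_3_cases[OF that(3)]; insert that(1))
      (auto simp: U_def W_def S_def grid_def)
  have sum: "S i j = U i j + W i j" if "i < 3" "j < 3" for i j
    by (rule less_3_cases[OF that(1)]; rule less_3_cases[OF that(2)])
      (simp_all add: U_def W_def S_def grid_def)
  have homs: "ladder_homs U = 1009777762945695534094508354448263"
    "ladder_homs W = 1009830956979098495329525462040825"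
    "ladder_homs S = 33089269964614064246796394797690662242"
    unfolding U_def W_def S_def by (rule ladder_homs_U ladder_homs_W ladder_homs_U_plus_W)+
  have N: "0 \<le> ?N (step_kernel X)" "?N (step_kernel X) ^ 15 = ladder_homs X / 3 ^ 10"
    if "X \<in> {U, W, S}" for X
  proof -
    have "0 \<le> ladder_homs X" using that homs by auto
    then show "0 \<le> ?N (step_kernel X)" "?N (step_kernel X) ^ 15 = ladder_homs X / 3 ^ 10"
      using r_norm_step_kernel[OF f(1) sym[OF that] nonneg[OF that]] by simp_all
  qed
  have "(\<lambda>p. step_kernel U p + step_kernel W p) = step_kernel S"
    by (simp add: step_kernel_def sum third_less fun_eq_iff)
  moreover have "step_kernel X \<in> kernels" if "X \<in> {U, W, S}" for X
    using sym[OF that] by (rule step_kernel_in_kernels)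
  ultimately have "?N (step_kernel S) \<le> ?N (step_kernel U) + ?N (step_kernel W)"
    using triangle[of "step_kernel U" "step_kernel W"] by simp
  \<comment> \<open>Fifteenth powers remove the roots, which leaves a comparison of explicit
    rationals.\<close>
  then have "?N (step_kernel S) ^ 15 \<le> (?N (step_kernel U) + ?N (step_kernel W)) ^ 15"
    using N(1)[of S] by (intro power_mono) simp_all
  also have "\<dots> \<le> 2 ^ 14 * (?N (step_kernel U) ^ 15 + ?N (step_kernel W) ^ 15)"
    using N(1) by (intro power_15_mean) simp_all
  \<comment> \<open>Up to the common factor \<open>1 / 3 ^ 10\<close> this reads
    \<open>ladder_homs S \<le> 2 ^ 14 * (ladder_homs U + ladder_homs W)\<close>, which the computed
    integers refute.\<close>
  finally show False
    by (simp add: N(2) homs)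
qed

end
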